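(* Let $(V, V^+, B)$ be a base normed space and let $X$ be any real normed linear space. Let $V_X := V \oplus_{\infty} X$, let $$V_X^+ := \{ (u, x) \in V \oplus X : u \in V^+ \text{ and } \Vert u \Vert \ge \Vert x \Vert \},$$ and let $B_X := B \times X_1$, where $X_1$ is the closed unit ball of $X$. Then $(V_X, V_X^+, B_X)$ is a base normed space (with base norm equal to the norm of $V \oplus_\infty X$).
   Context: A real ordered vector space $(V, V^+)$ is a real vector space $V$ with a cone $V^+$, i.e. a nonempty subset closed under addition and under multiplication by non-negative reals. A convex subset $B \subset V^+$ is called a base of $V^+$ if $0 \notin B$ and for each $u \in V^+$ with $u \neq 0$ there are a unique $b \in B$ and a real number $k > 0$ such that $u = k b$. If $V^+$ is generating (i.e. $V = V^+ - V^+$), then $K := \operatorname{co}(B \cup -B)$ is an absolutely convex absorbing set in $V$, and its gauge (Minkowski functional) is a seminorm $\Vert\cdot\Vert_B$ on $V$, called the base seminorm generated by $B$. When $V^+$ is generating and $\Vert\cdot\Vert_B$ is a norm, $(V, V^+, B)$ is called a base normed space; $V$ is then equipped with the norm $\Vert\cdot\Vert = \Vert\cdot\Vert_B$. $V \oplus_\infty X$ denotes the linear direct sum $V \oplus X$ with the norm $\Vert (v, x) \Vert_\infty = \max\{ \Vert v \Vert, \Vert x \Vert \}$. *)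

theory Defs
  imports "HOL-Analysis.Analysis"
begin

definition ordered_vector_space :: "'a::real_vector set \<Rightarrow> bool" where
  "ordered_vector_space P \<longleftrightarrow> P \<noteq> {} \<and> (\<forall>u\<in>P. \<forall>v\<in>P. u + v \<in> P) \<and> conic P"

definition base_of_cone :: "'a::real_vector set \<Rightarrow> 'a set \<Rightarrow> bool" where
  "base_of_cone P B \<longleftrightarrow>
     convex B \<and> B \<subseteq> P \<and> 0 \<notin> B \<and>
     (\<forall>u\<in>P. u \<noteq> 0 \<longrightarrow> (\<exists>!p. case p of (b, k) \<Rightarrow> b \<in> B \<and> (k::real) > 0 \<and> u = k *\<^sub>R b))"

definition generating_cone :: "'a::real_vector set \<Rightarrow> bool" where
  "generating_cone P \<longleftrightarrow> (\<forall>v. \<exists>u\<in>P. \<exists>w\<in>P. v = u - w)"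

text \<open>The infimum is meaningful only when the set is nonempty, as it is for absorbing \<open>K\<close>.\<close>

definition minkowski_functional :: "'a::real_vector set \<Rightarrow> 'a \<Rightarrow> real" where
  "minkowski_functional K v = Inf {t. t > 0 \<and> v \<in> (\<lambda>w. t *\<^sub>R w) ` K}"

definition base_seminorm :: "'a::real_vector set \<Rightarrow> 'a \<Rightarrow> real" where
  "base_seminorm B = minkowski_functional (convex hull (B \<union> uminus ` B))"

definition is_norm :: "('a::real_vector \<Rightarrow> real) \<Rightarrow> bool" where
  "is_norm N \<longleftrightarrow>
     (\<forall>v. N v \<ge> 0) \<and> (\<forall>v. N v = 0 \<longleftrightarrow> v = 0) \<and>
     (\<forall>c v. N (c *\<^sub>R v) = \<bar>c\<bar> * N v) \<and> (\<forall>v w. N (v + w) \<le> N v + N w)"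

text \<open>
  The condition \<open>B \<noteq> {}\<close> excludes only the zero space with empty base, in which
  the hull of \<open>B \<union> -B\<close> is empty, hence not absorbing, and its gauge is not defined.
  For a generating cone with nonempty base that hull is always absorbing.
\<close>

definition base_normed_space :: "'a::real_vector set \<Rightarrow> 'a set \<Rightarrow> bool" where
  "base_normed_space P B \<longleftrightarrow>
     ordered_vector_space P \<and> base_of_cone P B \<and> B \<noteq> {} \<and>
     generating_cone P \<and> is_norm (base_seminorm B)"

text \<open>
  The space \<open>V \<oplus>\<^sub>\<infinity> X\<close> is the product type with the norm below; the library norm
  on products is the Euclidean one. The first argument \<open>N\<close> is the norm of \<open>V\<close>, which need
  not be a type class norm.
\<close>

definition max_norm :: "('a::real_vector \<Rightarrow> real) \<Rightarrow> 'a \<times> 'b::real_normed_vector \<Rightarrow> real" where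
  "max_norm N = (\<lambda>(v, x). max (N v) (norm x))"

definition sum_cone ::
  "('a::real_vector \<Rightarrow> real) \<Rightarrow> 'a set \<Rightarrow> ('a \<times> 'b::real_normed_vector) set" where
  "sum_cone N P = {(u, x). u \<in> P \<and> N u \<ge> norm x}"

definition sum_base :: "'a::real_vector set \<Rightarrow> ('a \<times> 'b::real_normed_vector) set" where
  "sum_base B = B \<times> cball 0 1"

end

theory Submission
  imports Defs
begin

text \<open>
  Write \<open>N\<close> for the base seminorm of \<open>B\<close> and \<open>K\<close> for the convex hull of \<open>B \<union> -B\<close>, so that \<open>K\<close> consists
  of the vectors \<open>s b - r c\<close> with \<open>b, c \<in> B\<close>, \<open>s, r \<ge> 0\<close> and \<open>s + r = 1\<close>. Two facts carry the proof.

  First, \<open>N (k b) = k\<close> for \<open>b \<in> B\<close> and \<open>k \<ge> 0\<close>. The uniqueness in the notion of a base says that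
  the coefficients of a cone element add up consistently
  (\<open>base_coefficients_add\<close>), so \<open>b = t (s c - r d)\<close> forces \<open>1 + t r = t s\<close> and hence \<open>t \<ge> 1\<close>.
  Consequently \<open>N\<close> is additive on the cone, which makes the new cone closed under addition
  and lets the coefficient of \<open>u\<close> with respect to \<open>B\<close> be compared with \<open>norm x\<close>.

  Second, the hull for the enlarged base is the whole product of \<open>K\<close> with the unit ball
  (\<open>convex_hull_symmetrised_Times\<close>): a pair \<open>(s b - r c, x)\<close> equals
  \<open>s (b, x) - r (c, -x)\<close> because \<open>s x + r x = x\<close>. The gauge of a product is the maximum of
  the gauges of the factors, which gives the norm; that it is a norm is then immediate.
\<close>

section \<open>The hull of a convex set and its reflection\<close>

lemma convex_nonneg_combination:
  fixes B :: "'a::real_vector set"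
  assumes "convex B" "b \<in> B" "c \<in> B" "0 \<le> k" "0 \<le> l"
  obtains d where "d \<in> B" "k *\<^sub>R b + l *\<^sub>R c = (k + l) *\<^sub>R d"
proof (cases "k + l = 0")
  case True
  then show ?thesis
    using assms that[of b] by (simp add: add_nonneg_eq_0_iff)
next
  case False
  then have pos: "0 < k + l"
    using assms by simp
  have "(k / (k + l)) *\<^sub>R b + (l / (k + l)) *\<^sub>R c \<in> B"
    using assms pos by (intro convexD) (simp_all flip: add_divide_distrib)
  then show ?thesis
    by (rule that) (use pos in \<open>simp add: scaleR_add_right\<close>)
qed

text \<open>
  The right-hand side is convex: in a convex combination of two of its elements, the terms from
  \<open>B\<close> merge into a multiple of a single element of \<open>B\<close>, and so do the terms from \<open>-B\<close>.
\<close>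
lemma convex_hull_symmetrised:
  fixes B :: "'a::real_vector set"
  assumes "convex B"
  shows "convex hull (B \<union> uminus ` B) =
    {s *\<^sub>R b - r *\<^sub>R c |s r b c. 0 \<le> s \<and> 0 \<le> r \<and> s + r = 1 \<and> b \<in> B \<and> c \<in> B}" (is "_ = ?R")
proof
  have "B \<subseteq> ?R"
  proof
    fix b assume "b \<in> B"
    moreover have "b = 1 *\<^sub>R b - 0 *\<^sub>R b" by simp
    ultimately show "b \<in> ?R" by force
  qed
  moreover have "uminus ` B \<subseteq> ?R"
  proof clarify
    fix b assume "b \<in> B"
    moreover have "- b = 0 *\<^sub>R b - 1 *\<^sub>R b" by simp
    ultimately show "\<exists>s r b' c. - b = s *\<^sub>R b' - r *\<^sub>R c \<and> 0 \<le> s \<and> 0 \<le> r \<and> s + r = 1 \<and> b' \<in> B \<and> c \<in> B"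
      by force
  qed
  moreover have "convex ?R"
  proof (rule convexI)
    fix x y and u v :: real
    assume "x \<in> ?R" "y \<in> ?R" and uv: "0 \<le> u" "0 \<le> v" "u + v = 1"
    then obtain s r b c s' r' b' c' where
        x: "x = s *\<^sub>R b - r *\<^sub>R c" "0 \<le> s" "0 \<le> r" "s + r = 1" "b \<in> B" "c \<in> B" and
        y: "y = s' *\<^sub>R b' - r' *\<^sub>R c'" "0 \<le> s'" "0 \<le> r'" "s' + r' = 1" "b' \<in> B" "c' \<in> B"
      by blast
    obtain d where d: "d \<in> B" "(u * s) *\<^sub>R b + (v * s') *\<^sub>R b' = (u * s + v * s') *\<^sub>R d"
      using convex_nonneg_combination[OF assms x(5) y(5), of "u * s" "v * s'"] x y uv
      by (metis mult_nonneg_nonneg)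
    obtain e where e: "e \<in> B" "(u * r) *\<^sub>R c + (v * r') *\<^sub>R c' = (u * r + v * r') *\<^sub>R e"
      using convex_nonneg_combination[OF assms x(6) y(6), of "u * r" "v * r'"] x y uv
      by (metis mult_nonneg_nonneg)
    have "u *\<^sub>R x + v *\<^sub>R y =
        ((u * s) *\<^sub>R b + (v * s') *\<^sub>R b') - ((u * r) *\<^sub>R c + (v * r') *\<^sub>R c')"
      by (simp add: x(1) y(1) algebra_simps)
    then have "u *\<^sub>R x + v *\<^sub>R y = (u * s + v * s') *\<^sub>R d - (u * r + v * r') *\<^sub>R e"
      unfolding d(2) e(2) .
    moreover have "u * s + v * s' + (u * r + v * r') = u * (s + r) + v * (s' + r')"
      by (simp add: algebra_simps)
    then have "u * s + v * s' + (u * r + v * r') = 1"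
      using x(4) y(4) uv(3) by simp
    moreover have "0 \<le> u * s + v * s'" "0 \<le> u * r + v * r'"
      using x y uv by simp_all
    ultimately show "u *\<^sub>R x + v *\<^sub>R y \<in> ?R"
      using d(1) e(1) by blast
  qed
  ultimately show "convex hull (B \<union> uminus ` B) \<subseteq> ?R"
    by (intro hull_minimal Un_least)
  show "?R \<subseteq> convex hull (B \<union> uminus ` B)"
  proof clarify
    fix s r :: real and b c
    assume sr: "0 \<le> s" "0 \<le> r" "s + r = 1" and bc: "b \<in> B" "c \<in> B"
    have "b \<in> convex hull (B \<union> uminus ` B)" "- c \<in> convex hull (B \<union> uminus ` B)"
      using bc by (auto intro: hull_inc)
    then have "s *\<^sub>R b + r *\<^sub>R (- c) \<in> convex hull (B \<union> uminus ` B)"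
      using sr by (intro convexD[OF convex_convex_hull])
    then show "s *\<^sub>R b - r *\<^sub>R c \<in> convex hull (B \<union> uminus ` B)" by simp
  qed
qed

text \<open>
  The inclusion from right to left is the point: pairing \<open>x\<close> with \<open>b\<close> and \<open>-x\<close> with \<open>c\<close> in a
  representation \<open>s b - r c\<close> of the first coordinate makes the second coordinate
  \<open>(s + r) x = x\<close>, whatever \<open>s\<close> and \<open>r\<close> are.
\<close>
lemma convex_hull_symmetrised_Times:
  fixes B :: "'a::real_vector set" and C :: "'b::real_vector set"
  assumes B: "convex B" and C: "convex C" and sym: "uminus ` C = C"
  shows "convex hull (B \<times> C \<union> uminus ` (B \<times> C)) = (convex hull (B \<union> uminus ` B)) \<times> C"
    (is "?L = ?R")
proof
  have "B \<times> C \<union> uminus ` (B \<times> C) \<subseteq> ?R"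
    using sym hull_subset[of "B \<union> uminus ` B" convex] by fastforce
  then show "?L \<subseteq> ?R"
    by (rule hull_minimal) (intro convex_Times C convex_convex_hull)
  show "?R \<subseteq> ?L"
  proof
    fix p assume "p \<in> ?R"
    then obtain s r b c x where p: "p = (s *\<^sub>R b - r *\<^sub>R c, x)" "0 \<le> s" "0 \<le> r" "s + r = 1"
        "b \<in> B" "c \<in> B" "x \<in> C"
      unfolding convex_hull_symmetrised[OF B] by auto
    have "p = s *\<^sub>R (b, x) - r *\<^sub>R (c, - x)"
      using p(1,4) by (simp flip: scaleR_add_left)
    moreover have "- x \<in> C"
      using p(7) sym by auto
    ultimately show "p \<in> ?L"
      unfolding convex_hull_symmetrised[OF convex_Times[OF B C]] using p by blast
  qed
qed

section \<open>Gauges\<close>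

lemma mem_scaled_mono:
  fixes K :: "'a::real_vector set"
  assumes K: "convex K" "0 \<in> K" and v: "v \<in> (\<lambda>w. s *\<^sub>R w) ` K" and st: "0 < s" "s \<le> t"
  shows "v \<in> (\<lambda>w. t *\<^sub>R w) ` K"
proof -
  obtain w where w: "w \<in> K" "v = s *\<^sub>R w"
    using v by blast
  have "(s / t) *\<^sub>R w + (1 - s / t) *\<^sub>R 0 \<in> K"
    using K w st by (intro convexD) auto
  then have "(s / t) *\<^sub>R w \<in> K" by simp
  moreover have "v = t *\<^sub>R ((s / t) *\<^sub>R w)"
    using w st by simp
  ultimately show ?thesis by blast
qed

lemma minkowski_functional_le:
  assumes "0 < t" "v \<in> (\<lambda>w. t *\<^sub>R w) ` K"
  shows "minkowski_functional K v \<le> t"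
  unfolding minkowski_functional_def using assms
  by (intro cInf_lower bdd_belowI[of _ 0]) auto

text \<open>
  The admissible scales for a pair are the common admissible scales of its components;
  both sets of scales are upward closed, so the infimum of the intersection is the larger infimum.
\<close>
lemma minkowski_functional_Times_cball:
  fixes K :: "'a::real_vector set" and x :: "'b::real_normed_vector"
  assumes K: "convex K" "0 \<in> K" and absorb: "\<exists>t>0. v \<in> (\<lambda>w. t *\<^sub>R w) ` K"
  shows "minkowski_functional (K \<times> cball 0 1) (v, x) = max (minkowski_functional K v) (norm x)"
    (is "_ = ?m")
proof -
  let ?T = "{t. 0 < t \<and> v \<in> (\<lambda>w. t *\<^sub>R w) ` K}"
  have ne: "?T \<noteq> {}"
    using absorb by blast
  have scaled_Times: "(v, x) \<in> (\<lambda>w. t *\<^sub>R w) ` (K \<times> cball 0 1) \<longleftrightarrow>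
      v \<in> (\<lambda>w. t *\<^sub>R w) ` K \<and> norm x \<le> t" if t: "0 < t" for t
  proof
    assume "(v, x) \<in> (\<lambda>w. t *\<^sub>R w) ` (K \<times> cball 0 1)"
    then obtain q where q: "(v, x) = t *\<^sub>R q" "q \<in> K \<times> cball 0 1"
      by (rule imageE)
    have "v = t *\<^sub>R fst q" "fst q \<in> K" "x = t *\<^sub>R snd q" "norm (snd q) \<le> 1"
      using q(2) arg_cong[OF q(1), of fst] arg_cong[OF q(1), of snd] by (auto simp: mem_Times_iff)
    then show "v \<in> (\<lambda>w. t *\<^sub>R w) ` K \<and> norm x \<le> t"
      using t mult_left_mono[of "norm (snd q)" 1 t] by auto
  next
    assume "v \<in> (\<lambda>w. t *\<^sub>R w) ` K \<and> norm x \<le> t"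
    then obtain w where w: "v = t *\<^sub>R w" "w \<in> K" and x: "norm x \<le> t"
      by blast
    have "(v, x) = t *\<^sub>R (w, (1 / t) *\<^sub>R x)" "(1 / t) *\<^sub>R x \<in> cball 0 1"
      using w x t by auto
    then show "(v, x) \<in> (\<lambda>w. t *\<^sub>R w) ` (K \<times> cball 0 1)"
      using w by blast
  qed
  have above: "v \<in> (\<lambda>w. t *\<^sub>R w) ` K" if t: "minkowski_functional K v < t" for t
  proof -
    obtain s where "s \<in> ?T" "s < t"
      using cInf_lessD[OF ne] t unfolding minkowski_functional_def by blast
    then show ?thesis
      using mem_scaled_mono[OF K, of v s t] by simp
  qed
  have m0: "0 \<le> ?m"
    by (simp add: le_max_iff_disj)
  let ?S = "{t. 0 < t \<and> (v, x) \<in> (\<lambda>w. t *\<^sub>R w) ` (K \<times> cball 0 1)}"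
  have in_S: "t \<in> ?S" if "?m < t" for t
  proof -
    have "0 < t" using m0 that by linarith
    then show ?thesis
      using scaled_Times[of t] above[of t] that by simp
  qed
  have lower: "?m \<le> t" if "t \<in> ?S" for t
    using that scaled_Times[of t] minkowski_functional_le[of t v K] by auto
  have "Inf ?S = ?m"
  proof (rule antisym)
    show "Inf ?S \<le> ?m"
    proof (rule dense_ge)
      fix t assume "?m < t"
      then show "Inf ?S \<le> t"
        using cInf_lower[OF in_S bdd_belowI[OF lower]] by blast
    qed
    show "?m \<le> Inf ?S"
      using in_S[of "?m + 1"] by (intro cInf_greatest lower) auto
  qed
  then show ?thesis
    unfolding minkowski_functional_def .
qed

section \<open>Bases of cones\<close>

lemma base_coefficient_unique:
  assumes "base_of_cone P B" and "conic P" and b: "b \<in> B" and c: "c \<in> B"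
    and k: "0 < k" "0 < l" and eq: "k *\<^sub>R b = l *\<^sub>R c"
  shows "k = l" and "b = c"
proof -
  have "b \<in> P" "b \<noteq> 0"
    using assms(1) b unfolding base_of_cone_def by auto
  then have "k *\<^sub>R b \<in> P" "k *\<^sub>R b \<noteq> 0"
    using k assms(2) unfolding conic_def by auto
  then have "\<exists>!p. case p of (d, m) \<Rightarrow> d \<in> B \<and> (m::real) > 0 \<and> k *\<^sub>R b = m *\<^sub>R d"
    using assms(1) unfolding base_of_cone_def by blast
  then have "(b, k) = (c, l)"
    by (rule ex1E) (use b c k eq in \<open>metis (mono_tags, lifting) case_prod_conv\<close>)
  then show "k = l" "b = c" by auto
qed

lemma base_representation:
  assumes "base_of_cone P B" "B \<noteq> {}" "u \<in> P"
  obtains k b where "0 \<le> k" "b \<in> B" "u = k *\<^sub>R b"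
proof (cases "u = 0")
  case True
  then show ?thesis using that[of 0] assms(2) by auto
next
  case False
  then show ?thesis
    using assms that unfolding base_of_cone_def by (smt (verit) case_prodE ex1_implies_ex)
qed

text \<open>
  By convexity, \<open>k b + l c\<close> is \<open>k + l\<close> times an element of \<open>B\<close>, so uniqueness of the coefficient
  applies. In effect, the coefficient is an additive functional on the cone, equal to 1 on \<open>B\<close>.
\<close>
lemma base_coefficients_add:
  assumes base: "base_of_cone P B" and "conic P"
    and mem: "b \<in> B" "c \<in> B" "d \<in> B" and nonneg: "0 \<le> k" "0 \<le> l" "0 \<le> m"
    and eq: "k *\<^sub>R b + l *\<^sub>R c = m *\<^sub>R d"
  shows "k + l = m"
proof -
  obtain e where e: "e \<in> B" "(k + l) *\<^sub>R e = m *\<^sub>R d"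
    using convex_nonneg_combination[of B b c k l] base mem nonneg eq
    unfolding base_of_cone_def by metis
  have nz: "e \<noteq> 0" "d \<noteq> 0"
    using base e(1) mem(3) unfolding base_of_cone_def by auto
  show ?thesis
  proof (cases "k + l = 0 \<or> m = 0")
    case True
    then show ?thesis using e(2) nz by auto
  next
    case False
    then have "0 < k + l" "0 < m" using nonneg by linarith+
    then show ?thesis
      using base_coefficient_unique(1)[OF base assms(2) e(1) mem(3) _ _ e(2)] by simp
  qed
qed

section \<open>The base norm on the cone\<close>

text \<open>
  The scale 1 is admissible because \<open>b\<close> is in the hull. For a representation
  \<open>b = t (s c - r d)\<close>, moving the negative term to the left turns it into an identity between
  elements of the cone, whose coefficients can be compared.
\<close>
lemma base_seminorm_eq_1:
  assumes base: "base_of_cone P B" and "conic P" and b: "b \<in> B"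
  shows "base_seminorm B b = 1"
  unfolding base_seminorm_def minkowski_functional_def
proof (rule cInf_eq_minimum)
  have "b \<in> convex hull (B \<union> uminus ` B)"
    using b by (simp add: hull_inc)
  then show "1 \<in> {t. 0 < t \<and> b \<in> (\<lambda>w. t *\<^sub>R w) ` (convex hull (B \<union> uminus ` B))}"
    by force
next
  fix t assume "t \<in> {t. 0 < t \<and> b \<in> (\<lambda>w. t *\<^sub>R w) ` (convex hull (B \<union> uminus ` B))}"
  then obtain s r c d where t: "0 < t" and sr: "0 \<le> s" "0 \<le> r" "s + r = 1"
      and cd: "c \<in> B" "d \<in> B" and eq: "b = t *\<^sub>R (s *\<^sub>R c - r *\<^sub>R d)"
    using base unfolding base_of_cone_def by (auto simp: convex_hull_symmetrised)
  have "1 *\<^sub>R b + (t * r) *\<^sub>R d = (t * s) *\<^sub>R c"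
    using eq by (simp add: algebra_simps)
  then have "1 + t * r = t * s"
    using t sr by (intro base_coefficients_add[OF base assms(2) b cd(2,1)]) auto
  moreover have "t * s \<le> t * 1" "0 \<le> t * r"
    using t sr by (intro mult_left_mono mult_nonneg_nonneg; simp)+
  ultimately show "1 \<le> t" by linarith
qed

lemma base_seminorm_scaleR_base:
  assumes "base_normed_space P B" "b \<in> B" "0 \<le> k"
  shows "base_seminorm B (k *\<^sub>R b) = k"
proof -
  have "base_seminorm B (k *\<^sub>R b) = \<bar>k\<bar> * base_seminorm B b"
    using assms(1) unfolding base_normed_space_def is_norm_def by blast
  moreover have "base_seminorm B b = 1"
    using assms base_seminorm_eq_1
    unfolding base_normed_space_def ordered_vector_space_def by blast
  ultimately show ?thesis
    using assms(3) by simp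
qed

lemma base_seminorm_add_on_cone:
  assumes bns: "base_normed_space P B" and u: "u \<in> P" and w: "w \<in> P"
  shows "base_seminorm B (u + w) = base_seminorm B u + base_seminorm B w"
proof -
  have base: "base_of_cone P B" and ne: "B \<noteq> {}" and cone: "conic P" and sum: "u + w \<in> P"
    using bns u w unfolding base_normed_space_def ordered_vector_space_def by auto
  obtain k b where kb: "0 \<le> k" "b \<in> B" "u = k *\<^sub>R b"
    using base_representation[OF base ne u] .
  obtain l c where lc: "0 \<le> l" "c \<in> B" "w = l *\<^sub>R c"
    using base_representation[OF base ne w] .
  obtain m d where md: "0 \<le> m" "d \<in> B" "u + w = m *\<^sub>R d"
    using base_representation[OF base ne sum] .
  have "k + l = m"
    using base_coefficients_add[OF base cone kb(2) lc(2) md(2) kb(1) lc(1) md(1)] kb lc md by simp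
  then show ?thesis
    using base_seminorm_scaleR_base[OF bns] kb lc md by simp
qed

text \<open>
  If \<open>v = k b - l c\<close> with \<open>k + l > 0\<close>, then \<open>k + l\<close> is an admissible scale for \<open>v\<close>; if
  \<open>k + l = 0\<close>, then \<open>v = 0\<close> and every positive scale is. The gauge of \<open>v\<close> is therefore
  the infimum of a nonempty set and not a default value of \<open>Inf\<close>.
\<close>
lemma base_hull_absorbing:
  assumes base: "base_of_cone P B" and ne: "B \<noteq> {}" and "generating_cone P"
  shows "0 \<in> convex hull (B \<union> uminus ` B)"
    and "\<exists>t>0. v \<in> (\<lambda>w. t *\<^sub>R w) ` (convex hull (B \<union> uminus ` B))"
proof -
  have hull: "convex hull (B \<union> uminus ` B) =
    {s *\<^sub>R b - r *\<^sub>R c |s r b c. 0 \<le> s \<and> 0 \<le> r \<and> s + r = 1 \<and> b \<in> B \<and> c \<in> B}"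
    using base by (intro convex_hull_symmetrised) (simp add: base_of_cone_def)
  obtain a where a: "a \<in> B" using ne by blast
  have "0 = (1/2) *\<^sub>R a - (1/2) *\<^sub>R a" by simp
  then show zero: "0 \<in> convex hull (B \<union> uminus ` B)"
    unfolding hull using a by fastforce
  obtain u w where uw: "u \<in> P" "w \<in> P" "v = u - w"
    using assms(3) unfolding generating_cone_def by blast
  obtain k b where kb: "0 \<le> k" "b \<in> B" "u = k *\<^sub>R b"
    using base_representation[OF base ne uw(1)] .
  obtain l c where lc: "0 \<le> l" "c \<in> B" "w = l *\<^sub>R c"
    using base_representation[OF base ne uw(2)] .
  show "\<exists>t>0. v \<in> (\<lambda>w. t *\<^sub>R w) ` (convex hull (B \<union> uminus ` B))"
  proof (cases "k + l = 0")
    case True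
    then have "v = 1 *\<^sub>R 0"
      using uw kb lc by (simp add: add_nonneg_eq_0_iff)
    then show ?thesis using zero zero_less_one by blast
  next
    case False
    then have pos: "0 < k + l" using kb lc by simp
    have "(k / (k + l)) *\<^sub>R b - (l / (k + l)) *\<^sub>R c \<in> convex hull (B \<union> uminus ` B)"
      unfolding hull using kb lc pos by (force simp flip: add_divide_distrib)
    moreover have "v = (k + l) *\<^sub>R ((k / (k + l)) *\<^sub>R b - (l / (k + l)) *\<^sub>R c)"
      using pos uw kb lc by (simp add: scaleR_diff_right)
    ultimately show ?thesis using pos by blast
  qed
qed

section \<open>The sum with a normed space\<close>

lemma base_seminorm_sum_base:
  assumes "base_normed_space P B"
  shows "base_seminorm (sum_base B :: ('a::real_vector \<times> 'b::real_normed_vector) set) =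
    max_norm (base_seminorm B)"
proof
  fix p :: "'a \<times> 'b"
  obtain v x where p: "p = (v, x)" by force
  have base: "base_of_cone P B" "B \<noteq> {}" "generating_cone P" and conv: "convex B"
    using assms unfolding base_normed_space_def base_of_cone_def by auto
  have sym: "uminus ` cball (0::'b) 1 = cball 0 1"
  proof -
    have "x \<in> uminus ` cball 0 1" if "x \<in> cball 0 1" for x :: 'b
      by (rule image_eqI[of _ _ "- x"]) (use that in auto)
    then show ?thesis by auto
  qed
  show "base_seminorm (sum_base B) p = max_norm (base_seminorm B) p"
    unfolding p base_seminorm_def sum_base_def max_norm_def
      convex_hull_symmetrised_Times[OF conv convex_cball sym]
    using minkowski_functional_Times_cball[OF convex_convex_hull base_hull_absorbing[OF base]]
    by simp
qed

lemma is_norm_max_norm: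
  assumes "is_norm N"
  shows "is_norm (max_norm N :: ('a::real_vector \<times> 'b::real_normed_vector) \<Rightarrow> real)"
proof -
  have N: "0 \<le> N v" "N v = 0 \<longleftrightarrow> v = 0" "N (c *\<^sub>R v) = \<bar>c\<bar> * N v" "N (v + w) \<le> N v + N w"
    for c v w
    using assms unfolding is_norm_def by auto
  show ?thesis
    unfolding is_norm_def max_norm_def
  proof (intro conjI allI; clarify)
    fix v :: 'a and x :: 'b
    show "0 \<le> max (N v) (norm x)"
      by (simp add: le_max_iff_disj)
    show "max (N v) (norm x) = 0 \<longleftrightarrow> (v, x) = 0"
      using N(1,2)[of v] by (auto simp: max_def zero_prod_def)
  next
    fix c :: real and v :: 'a and x :: 'b
    show "(case c *\<^sub>R (v, x) of (v, x) \<Rightarrow> max (N v) (norm x)) = \<bar>c\<bar> * max (N v) (norm x)"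
      by (simp add: N(3) max_mult_distrib_left)
  next
    fix v w :: 'a and x y :: 'b
    show "(case (v, x) + (w, y) of (v, x) \<Rightarrow> max (N v) (norm x)) \<le>
        max (N v) (norm x) + max (N w) (norm y)"
      using N(4)[of v w] norm_triangle_ineq[of x y] by (auto intro: order_trans add_mono)
  qed
qed

text \<open>Closure under addition needs more than the triangle inequality: the norm is additive on \<open>P\<close>.\<close>
lemma ordered_vector_space_sum_cone:
  assumes bns: "base_normed_space P B"
  shows "ordered_vector_space
    (sum_cone (base_seminorm B) P :: ('a::real_vector \<times> 'b::real_normed_vector) set)"
proof -
  let ?N = "base_seminorm B"
  have P: "P \<noteq> {}" "\<And>u w. u \<in> P \<Longrightarrow> w \<in> P \<Longrightarrow> u + w \<in> P" "conic P"
    and N: "\<And>v. 0 \<le> ?N v" "\<And>c v. ?N (c *\<^sub>R v) = \<bar>c\<bar> * ?N v"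
    using bns unfolding base_normed_space_def ordered_vector_space_def is_norm_def by auto
  obtain u where "u \<in> P" using P(1) by blast
  then have "(u, 0) \<in> (sum_cone ?N P :: ('a \<times> 'b) set)"
    using N(1) unfolding sum_cone_def by simp
  then have "sum_cone ?N P \<noteq> ({} :: ('a \<times> 'b) set)"
    by blast
  moreover have "p + q \<in> sum_cone ?N P"
    if "p \<in> sum_cone ?N P" "q \<in> sum_cone ?N P" for p q :: "'a \<times> 'b"
    using that P(2) base_seminorm_add_on_cone[OF bns] unfolding sum_cone_def
    by (fastforce intro: norm_triangle_mono)
  moreover have "conic (sum_cone ?N P :: ('a \<times> 'b) set)"
    using P(3) unfolding conic_def sum_cone_def by (auto simp: N(2) mult_left_mono)
  ultimately show ?thesis
    unfolding ordered_vector_space_def by blast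
qed

text \<open>
  A nonzero pair \<open>(u, x)\<close> of the cone has \<open>u \<noteq> 0\<close>, since \<open>norm x \<le> N u\<close>. Its coefficient must be
  that of \<open>u = k b\<close>, and the condition \<open>norm x \<le> N u = k\<close> says exactly that \<open>x / k\<close> is in the
  unit ball.
\<close>
lemma base_of_cone_sum_base:
  assumes bns: "base_normed_space P B"
  shows "base_of_cone (sum_cone (base_seminorm B) P)
    (sum_base B :: ('a::real_vector \<times> 'b::real_normed_vector) set)"
proof -
  let ?N = "base_seminorm B"
  have base: "base_of_cone P B" and ne: "B \<noteq> {}" and cone: "conic P"
    using bns unfolding base_normed_space_def ordered_vector_space_def by auto
  have B: "convex B" "B \<subseteq> P" "0 \<notin> B"
    using base unfolding base_of_cone_def by auto
  have N1: "?N b = 1" if "b \<in> B" for b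
    using base_seminorm_eq_1[OF base cone that] .
  have "\<exists>!q. case q of (a, k) \<Rightarrow> a \<in> sum_base B \<and> (k::real) > 0 \<and> p = k *\<^sub>R a"
    if p: "p \<in> sum_cone ?N P" "p \<noteq> 0" for p :: "'a \<times> 'b"
  proof -
    obtain u x where ux: "p = (u, x)" "u \<in> P" "norm x \<le> ?N u"
      using p(1) unfolding sum_cone_def by auto
    obtain k b where kb: "0 \<le> k" "b \<in> B" "u = k *\<^sub>R b"
      using base_representation[OF base ne ux(2)] .
    have Nu: "?N u = k"
      using base_seminorm_scaleR_base[OF bns kb(2,1)] kb(3) by simp
    have "k \<noteq> 0"
      using p(2) ux kb Nu by (auto simp: zero_prod_def)
    then have k: "0 < k" using kb(1) by simp
    show ?thesis
    proof (rule ex1I[of _ "((b, (1 / k) *\<^sub>R x), k)"])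
      show "case ((b, (1 / k) *\<^sub>R x), k) of (a, k) \<Rightarrow> a \<in> sum_base B \<and> k > 0 \<and> p = k *\<^sub>R a"
        using k kb ux Nu unfolding sum_base_def by simp
    next
      fix q :: "('a \<times> 'b) \<times> real"
      assume q: "case q of (a, k) \<Rightarrow> a \<in> sum_base B \<and> k > 0 \<and> p = k *\<^sub>R a"
      obtain c y l where q': "q = ((c, y), l)" by (metis prod.exhaust)
      have l: "c \<in> B" "0 < l" "u = l *\<^sub>R c" "x = l *\<^sub>R y"
        using q ux unfolding q' sum_base_def by auto
      have "k = l" "b = c"
        using base_coefficient_unique[OF base cone kb(2) l(1) k l(2)] kb(3) l(3) by auto
      then show "q = ((b, (1 / k) *\<^sub>R x), k)"
        using l k by (simp add: q')
    qed
  qed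
  moreover have "convex (sum_base B :: ('a \<times> 'b) set)"
    unfolding sum_base_def by (intro convex_Times B convex_cball)
  moreover have "(sum_base B :: ('a \<times> 'b) set) \<subseteq> sum_cone ?N P"
    using B(2) N1 unfolding sum_base_def sum_cone_def by auto
  moreover have "(0 :: 'a \<times> 'b) \<notin> sum_base B"
    using B(3) unfolding sum_base_def by (auto simp: zero_prod_def)
  ultimately show ?thesis
    unfolding base_of_cone_def by blast
qed

text \<open>
  Adding \<open>norm x\<close> times a fixed base element to both parts of \<open>v = u - w\<close> leaves the difference
  unchanged and makes the norm of the first part large enough to dominate \<open>x\<close>.
\<close>
lemma generating_cone_sum_cone:
  assumes bns: "base_normed_space P B"
  shows "generating_cone
    (sum_cone (base_seminorm B) P :: ('a::real_vector \<times> 'b::real_normed_vector) set)"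
  unfolding generating_cone_def
proof
  let ?N = "base_seminorm B"
  have P: "\<And>u w. u \<in> P \<Longrightarrow> w \<in> P \<Longrightarrow> u + w \<in> P" "conic P" "generating_cone P" "B \<noteq> {}" "B \<subseteq> P"
    and N: "\<And>v. 0 \<le> ?N v"
    using bns
    unfolding base_normed_space_def ordered_vector_space_def base_of_cone_def is_norm_def by auto
  fix p :: "'a \<times> 'b"
  obtain v x where p: "p = (v, x)" by force
  obtain b where b: "b \<in> B" using P(4) by blast
  obtain u w where uw: "u \<in> P" "w \<in> P" "v = u - w"
    using P(3) unfolding generating_cone_def by blast
  let ?s = "norm x *\<^sub>R b"
  have s: "?s \<in> P"
    using P(2,5) b unfolding conic_def by auto
  have "?N (u + ?s) = ?N u + norm x"
    using base_seminorm_add_on_cone[OF bns uw(1) s] base_seminorm_scaleR_base[OF bns b] by simp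
  then have "(u + ?s, x) \<in> sum_cone ?N P"
    using N[of u] P(1)[OF uw(1) s] unfolding sum_cone_def by simp
  moreover have "(w + ?s, 0) \<in> sum_cone ?N P"
    using N P(1)[OF uw(2) s] unfolding sum_cone_def by simp
  moreover have "p = (u + ?s, x) - (w + ?s, 0)"
    using p uw by simp
  ultimately show "\<exists>a\<in>sum_cone ?N P. \<exists>c\<in>sum_cone ?N P. p = a - c"
    by blast
qed

theorem theorem2p1:
  fixes P B :: "'v::real_vector set"
  assumes "base_normed_space P B"
  shows "base_normed_space
           (sum_cone (base_seminorm B) P :: ('v \<times> 'x::real_normed_vector) set) (sum_base B)
       \<and> base_seminorm (sum_base B :: ('v \<times> 'x) set) = max_norm (base_seminorm B)"
proof -
  have "is_norm (base_seminorm B)" "sum_base B \<noteq> ({} :: ('v \<times> 'x) set)"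
    using assms unfolding base_normed_space_def sum_base_def by auto
  then show ?thesis
    using base_seminorm_sum_base[OF assms, where ?'b = 'x]
      ordered_vector_space_sum_cone[OF assms] base_of_cone_sum_base[OF assms]
      generating_cone_sum_cone[OF assms] is_norm_max_norm[of "base_seminorm B"]
    unfolding base_normed_space_def by simp
qed

end
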